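(* Let $t, r$ be integers with $1 \leq t \leq r$, let $k$ be a positive integer, and let $\mathcal{H}$ be a hereditary family with $\mu(\mathcal{H}) \geq n_{\rm S}(r,t)$. Let $\mathcal{A}_1, \dots, \mathcal{A}_k$ be cross-$t$-intersecting subfamilies of $\mathcal{H}^{(\leq r)}$, and let $\mathcal{L}$ be a largest $t$-star of $\mathcal{H}^{(\leq r)}$. Then \[\sum_{i = 1}^k |\mathcal{A}_i| \leq \max\left\{ k|\mathcal{L}|, |\mathcal{H}^{(\leq r)}| \right\}.\]
   Context: All sets and families are finite. For a positive integer $k$, $[k] := \{1,\dots,k\}$. A family $\mathcal{H}$ is hereditary if every subset of every member of $\mathcal{H}$ is a member of $\mathcal{H}$. A base of a family $\mathcal{F}$ is a set $B \in \mathcal{F}$ that is not a proper subset of any member of $\mathcal{F}$; $\mu(\mathcal{F})$ denotes the size of a smallest base of $\mathcal{F}$. $\mathcal{H}^{(\leq r)} := \{H \in \mathcal{H} : |H| \leq r\}$. For a family $\mathcal{F}$ and a set $T$, $\mathcal{F}\langle T\rangle := \{F \in \mathcal{F} : T \subseteq F\}$; this is a $t$-star of $\mathcal{F}$ if $|T| = t$, and a largest $t$-star is one of maximum size among all $t$-stars of $\mathcal{F}$. A set $A$ $t$-intersects $B$ if $|A\cap B| \ge t$. Families $\mathcal{A}_1,\dots,\mathcal{A}_k$ are cross-$t$-intersecting if for all distinct $i,j \in [k]$, every set in $\mathcal{A}_i$ $t$-intersects every set in $\mathcal{A}_j$. Define $m(r,t) := \max\{2r, \frac{(r-t)(r-t+5)}{2}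 + (t-1)\}$ and $n_{\rm S}(r,t) := (r-t+1)\binom{m(r,t)}{t+1} + r$. *)

theory Defs
  imports Complex_Main
begin

definition finite_family :: "'a set set \<Rightarrow> bool" where
  "finite_family \<F> \<longleftrightarrow> finite \<F> \<and> (\<forall>F\<in>\<F>. finite F)"

definition hereditary :: "'a set set \<Rightarrow> bool" where
  "hereditary \<H> \<longleftrightarrow> (\<forall>H\<in>\<H>. \<forall>G. G \<subseteq> H \<longrightarrow> G \<in> \<H>)"

definition bases :: "'a set set \<Rightarrow> 'a set set" where
  "bases \<F> = {B \<in> \<F>. \<not> (\<exists>F\<in>\<F>. B \<subset> F)}"

(* A nonempty finite family always has a base; the value for the empty family,
   which has none, is unspecified. *)
definition min_base_size :: "'a set set \<Rightarrow> nat" where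
  "min_base_size \<F> = Min (card ` bases \<F>)"

definition upto_size :: "'a set set \<Rightarrow> nat \<Rightarrow> 'a set set" where
  "upto_size \<H> r = {H \<in> \<H>. card H \<le> r}"

(* The subfamily \<F>\<langle>T\<rangle>. *)
definition star_at :: "'a set set \<Rightarrow> 'a set \<Rightarrow> 'a set set" where
  "star_at \<F> T = {F \<in> \<F>. T \<subseteq> F}"

(* The centre T may be any t-element set, not necessarily contained in a member
   of the family. Finiteness is stated because card of an infinite set is 0. *)
definition t_star :: "nat \<Rightarrow> 'a set set \<Rightarrow> 'a set set \<Rightarrow> bool" where
  "t_star t \<F> \<S> \<longleftrightarrow> (\<exists>T. finite T \<and> card T = t \<and> \<S> = star_at \<F> T)"

definition largest_t_star :: "nat \<Rightarrow> 'a set set \<Rightarrow> 'a set set \<Rightarrow> bool" where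
  "largest_t_star t \<F> \<L> \<longleftrightarrow>
     t_star t \<F> \<L> \<and> (\<forall>\<S>. t_star t \<F> \<S> \<longrightarrow> card \<S> \<le> card \<L>)"

definition t_intersects :: "nat \<Rightarrow> 'a set \<Rightarrow> 'a set \<Rightarrow> bool" where
  "t_intersects t A B \<longleftrightarrow> t \<le> card (A \<inter> B)"

definition cross_t_intersecting :: "nat \<Rightarrow> nat \<Rightarrow> (nat \<Rightarrow> 'a set set) \<Rightarrow> bool" where
  "cross_t_intersecting t k \<A> \<longleftrightarrow>
     (\<forall>i\<in>{1..k}. \<forall>j\<in>{1..k}. i \<noteq> j \<longrightarrow>
        (\<forall>A\<in>\<A> i. \<forall>B\<in>\<A> j. t_intersects t A B))"

(* Used for 1 \<le> t \<le> r only, where no natural-number subtraction truncates.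
   The division is exact, since d * (d + 5) is always even. *)
definition m_bound :: "nat \<Rightarrow> nat \<Rightarrow> nat" where
  "m_bound r t = max (2 * r) ((r - t) * (r - t + 5) div 2 + (t - 1))"

definition n_S :: "nat \<Rightarrow> nat \<Rightarrow> nat" where
  "n_S r t = (r - t + 1) * (m_bound r t choose (t + 1)) + r"

end

theory Submission
  imports Defs
begin

text \<open>
  Call a set of \<open>U = \<Union>i. \<A> i\<close> good if it \<open>t\<close>-intersects every set of \<open>U\<close>. A set that lies in two
  different families is good, so with \<open>S\<close> the family of good sets the sum of sizes is at most
  \<open>k * card S + card (U - S)\<close>, and it suffices that
  \<open>card S / card \<L> + card (U - S) / card \<G> \<le> 1\<close>, where \<open>\<G> = upto_size \<H> r\<close>.

  If all sets of \<open>U\<close> share \<open>t\<close> elements, then \<open>U = S\<close> is part of a \<open>t\<close>-star. Otherwise fix a good set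
  \<open>C\<close>. Every set of \<open>U\<close> contains one of at most \<open>r choose t\<close> subsets \<open>T\<close> of \<open>C\<close> with \<open>t\<close> elements, and a
  good set containing \<open>T\<close> also contains a further element of some set of \<open>U\<close> that does not include \<open>T\<close>.
  So \<open>card S\<close> is at most \<open>r * (r choose t)\<close> times the size of a \<open>(t + 1)\<close>-star. Exchanging an element
  of the centre for another element of a base shows that dropping an element of the centre of a star
  enlarges the star by a large factor, which gives the inequality.
\<close>

section \<open>Bases and exchange of elements\<close>

lemma obtain_base:
  assumes "finite \<F>" "F \<in> \<F>"
  obtains B where "B \<in> bases \<F>" "F \<subseteq> B" "min_base_size \<F> \<le> card B"
proof -
  obtain B where B: "B \<in> \<F>" "F \<subseteq> B" "\<And>X. X \<in> \<F> \<Longrightarrow> B \<subseteq> X \<Longrightarrow> B = X"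
    using finite_has_maximal2[OF assms] by metis
  have base: "B \<in> bases \<F>"
    using B by (auto simp: bases_def)
  moreover have "finite (bases \<F>)"
    using assms(1) by (simp add: bases_def)
  then have "min_base_size \<F> \<le> card B"
    unfolding min_base_size_def using base by (intro Min_le) auto
  ultimately show thesis
    using that B(2) by blast
qed

text \<open>Double counting: replacing \<open>x\<close> in \<open>H\<close> by an element
  \<open>y\<close> of a large set \<open>b H\<close> of \<open>\<H>\<close> that includes
  \<open>H\<close> can be undone once \<open>y\<close> is recorded. Each \<open>H\<close> admits at
  least \<open>min_base_size \<H> - r\<close> choices of \<open>y\<close>, while a set of the star
  at \<open>T\<close> has at most \<open>r - card T\<close> elements that can be
  \<open>y\<close>.\<close>

lemma star_exchange:
  assumes fin: "finite_family \<H>" and her: "hereditary \<H>"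
    and x: "x \<notin> T" and T: "finite T"
  shows "(min_base_size \<H> - r) * card (star_at (upto_size \<H> r) (insert x T))
       \<le> (r - card T) * card (star_at (upto_size \<H> r) T)"
proof -
  let ?\<G> = "upto_size \<H> r"
  let ?X = "star_at ?\<G> (insert x T)" and ?Y = "star_at ?\<G> T"
  have finH: "finite \<H>" and finm: "\<And>H. H \<in> \<H> \<Longrightarrow> finite H"
    using fin by (auto simp: finite_family_def)
  have finX: "finite ?X" and finY: "finite ?Y"
    using finH by (auto simp: star_at_def upto_size_def)
  have "\<forall>H\<in>?X. \<exists>B. B \<in> \<H> \<and> H \<subseteq> B \<and> min_base_size \<H> \<le> card B"
  proof
    fix H assume "H \<in> ?X"
    then have "H \<in> \<H>" by (simp add: star_at_def upto_size_def)
    with finH obtain B where "B \<in> bases \<H>" "H \<subseteq> B" "min_base_size \<H> \<le> card B"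
      by (rule obtain_base)
    then show "\<exists>B. B \<in> \<H> \<and> H \<subseteq> B \<and> min_base_size \<H> \<le> card B"
      by (auto simp: bases_def)
  qed
  then obtain b where b: "\<And>H. H \<in> ?X \<Longrightarrow> b H \<in> \<H> \<and> H \<subseteq> b H \<and> min_base_size \<H> \<le> card (b H)"
    by metis
  let ?P = "Sigma ?X (\<lambda>H. b H - H)" and ?Q = "Sigma ?Y (\<lambda>K. K - T)"
  let ?f = "\<lambda>(H, y). (insert y (H - {x}), y)"
  have finQ: "finite ?Q"
    using finY by (rule finite_SigmaI) (auto simp: star_at_def upto_size_def intro: finm)
  have inj: "inj_on ?f ?P"
  proof (rule inj_on_inverseI)
    fix p assume "p \<in> ?P"
    then show "(\<lambda>(K, y). (insert x (K - {y}), y)) (?f p) = p"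
      by (auto simp: star_at_def)
  qed
  have image: "?f ` ?P \<subseteq> ?Q"
  proof
    fix q assume "q \<in> ?f ` ?P"
    then obtain H y where H: "H \<in> ?X" and y: "y \<in> b H" "y \<notin> H"
      and q: "q = (insert y (H - {x}), y)" by auto
    have HH: "H \<in> \<H>" "card H \<le> r" "insert x T \<subseteq> H"
      using H by (auto simp: star_at_def upto_size_def)
    have "insert y (H - {x}) \<subseteq> b H"
      using b[OF H] y by auto
    then have "insert y (H - {x}) \<in> \<H>"
      using her b[OF H] by (auto simp: hereditary_def)
    moreover have "card (insert y (H - {x})) = card H"
      using y HH finm[OF HH(1)] card_Suc_Diff1[of H x] by auto
    ultimately show "q \<in> ?Q"
      using q HH y x by (auto simp: star_at_def upto_size_def)
  qed
  have "(min_base_size \<H> - r) * card ?X = (\<Sum>H\<in>?X. min_base_size \<H> - r)"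
    by simp
  also have "\<dots> \<le> (\<Sum>H\<in>?X. card (b H - H))"
  proof (rule sum_mono)
    fix H assume H: "H \<in> ?X"
    then have "card (b H) - card H \<le> card (b H - H)"
      by (intro diff_card_le_card_Diff finm) (auto simp: star_at_def upto_size_def)
    with b[OF H] H show "min_base_size \<H> - r \<le> card (b H - H)"
      by (auto simp: star_at_def upto_size_def)
  qed
  also have "\<dots> = card ?P"
    using finX b finm by (intro card_SigmaI[symmetric]) auto
  also have "\<dots> \<le> card ?Q"
    using card_inj_on_le[OF inj image finQ] .
  also have "\<dots> = (\<Sum>K\<in>?Y. card (K - T))"
    using finY finm by (intro card_SigmaI) (auto simp: star_at_def upto_size_def)
  also have "\<dots> \<le> (\<Sum>K\<in>?Y. r - card T)"
    using T by (intro sum_mono) (auto simp: star_at_def upto_size_def card_Diff_subset)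
  also have "\<dots> = (r - card T) * card ?Y"
    by simp
  finally show ?thesis .
qed

section \<open>Covers by stars\<close>

lemma card_le_by_cover:
  assumes "finite I" and "\<F> \<subseteq> (\<Union>i\<in>I. \<S> i)"
    and "\<And>i. i \<in> I \<Longrightarrow> finite (\<S> i)" and "\<And>i. i \<in> I \<Longrightarrow> card (\<S> i) \<le> b"
  shows "card \<F> \<le> card I * b"
proof -
  have "card \<F> \<le> card (\<Union>i\<in>I. \<S> i)"
    using assms by (intro card_mono) auto
  also have "\<dots> \<le> (\<Sum>i\<in>I. card (\<S> i))"
    using assms(1) by (rule card_UN_le)
  also have "\<dots> \<le> card I * b"
    using sum_bounded_above[of I "\<lambda>i. card (\<S> i)" b] assms(4) by simp
  finally show ?thesis .
qed

text \<open>Serves with a good set as \<open>C\<close>, once for the bad sets \<open>U - S\<close>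
  and once for \<open>S\<close>, with a different bound \<open>b\<close> on a single star.\<close>

lemma card_le_by_stars:
  assumes C: "finite C" "card C \<le> r" and fin: "finite \<F>"
    and meets: "\<And>F. F \<in> \<F> \<Longrightarrow> t_intersects t F C"
    and bound: "\<And>T. T \<subseteq> C \<Longrightarrow> card T = t \<Longrightarrow> card (star_at \<F> T) \<le> b"
  shows "card \<F> \<le> (r choose t) * b"
proof -
  let ?I = "{T. T \<subseteq> C \<and> card T = t}"
  have "card \<F> \<le> card ?I * b"
  proof (rule card_le_by_cover[where \<S> = "star_at \<F>"])
    show "\<F> \<subseteq> (\<Union>T\<in>?I. star_at \<F> T)"
    proof
      fix F assume F: "F \<in> \<F>"
      then have "t \<le> card (F \<inter> C)"
        using meets by (simp add: t_intersects_def)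
      then obtain T where "T \<subseteq> F \<inter> C" "card T = t"
        by (meson obtain_subset_with_card_n)
      with F show "F \<in> (\<Union>T\<in>?I. star_at \<F> T)"
        by (auto simp: star_at_def)
    qed
  qed (use C fin bound in \<open>auto simp: star_at_def\<close>)
  also have "card ?I = card C choose t"
    using C(1) by (rule n_subsets)
  also have "\<dots> \<le> r choose t"
    using C(2) by (rule binomial_right_mono)
  finally show ?thesis
    by simp
qed

text \<open>If \<open>F\<close> met \<open>D\<close> only inside \<open>T\<close>, then
  \<open>F \<inter> D\<close> would be a proper subset of \<open>T\<close>, since \<open>D\<close>
  misses a point of \<open>T\<close>, and would have fewer than \<open>t\<close> elements. So
  \<open>F\<close> has a point in \<open>D - T\<close>, which can join the centre.\<close>

lemma card_star_le_extended_stars: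
  assumes T: "finite T" "card T = t" and D: "finite D" "card D \<le> r" "\<not> T \<subseteq> D"
    and fin: "finite \<F>"
    and meets: "\<And>F. F \<in> \<F> \<Longrightarrow> t_intersects t F D"
    and bound: "\<And>x. x \<notin> T \<Longrightarrow> card (star_at \<F> (insert x T)) \<le> b"
  shows "card (star_at \<F> T) \<le> r * b"
proof -
  have "card (star_at \<F> T) \<le> card (D - T) * b"
  proof (rule card_le_by_cover[where \<S> = "\<lambda>x. star_at \<F> (insert x T)"])
    show "star_at \<F> T \<subseteq> (\<Union>x\<in>D - T. star_at \<F> (insert x T))"
    proof
      fix F assume F: "F \<in> star_at \<F> T"
      have "\<not> F \<inter> D \<subseteq> T"
      proof
        assume "F \<inter> D \<subseteq> T"
        with D(3) have "F \<inter> D \<subset> T" by blast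
        then have "card (F \<inter> D) < t"
          using T psubset_card_mono by blast
        with F meets[of F] show False
          by (simp add: star_at_def t_intersects_def)
      qed
      with F show "F \<in> (\<Union>x\<in>D - T. star_at \<F> (insert x T))"
        by (auto simp: star_at_def)
    qed
  qed (use D fin bound in \<open>auto simp: star_at_def\<close>)
  also have "card (D - T) \<le> r"
    using D card_mono[of D "D - T"] by auto
  finally show ?thesis
    by simp
qed

section \<open>The weighted inequality for good sets\<close>

lemma mult_choose_le_choose_double: "r * (r choose t) \<le> (2 * r) choose (t + 1)"
proof -
  \<comment> \<open>This is the term \<open>i = t\<close> of the Vandermonde sum for
    \<open>r + r\<close>.\<close>
  have "(r choose t) * (r choose (t + 1 - t)) \<le> (\<Sum>i\<le>t + 1. (r choose i) * (r choose (t + 1 - i)))"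
    by (rule member_le_sum) auto
  also have "\<dots> = (2 * r) choose (t + 1)"
    by (simp only: vandermonde mult_2)
  finally show ?thesis
    by (simp add: mult.commute)
qed

text \<open>The inequality of fractions with denominators cleared. In the main case the good sets
  take at most the share \<open>(r - t) / (r - t + 1)\<close> and the bad ones at most
  \<open>1 / (r - t + 1)\<close>.\<close>

lemma good_part_weighted_bound:
  assumes t: "1 \<le> t" "t \<le> r"
    and fin: "finite_family \<H>" and her: "hereditary \<H>"
    and large: "n_S r t \<le> min_base_size \<H>"
    and U: "U \<subseteq> upto_size \<H> r"
    and L: "largest_t_star t (upto_size \<H> r) \<L>"
    and S: "S = {A \<in> U. \<forall>B\<in>U. t_intersects t A B}"
  shows "card S * card (upto_size \<H> r) + card \<L> * card (U - S) \<le> card \<L> * card (upto_size \<H> r)"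
proof -
  let ?\<G> = "upto_size \<H> r"
  define M where "M = m_bound r t choose (t + 1)"
  have finG: "finite ?\<G>" and finmem: "\<And>F. F \<in> ?\<G> \<Longrightarrow> finite F \<and> card F \<le> r"
    using fin by (auto simp: finite_family_def upto_size_def)
  have finU: "finite U" and finS: "finite S"
    using finite_subset[OF U finG] S by auto
  have SU: "S \<subseteq> U" using S by auto
  \<comment> \<open>The summand \<open>r\<close> of \<open>n_S r t\<close> makes up for the
    \<open>r\<close> subtracted in \<open>star_exchange\<close>.\<close>
  have \<mu>: "(r - t + 1) * M \<le> min_base_size \<H> - r"
    using large by (simp add: n_S_def M_def)
  have starL: "card (star_at ?\<G> T) \<le> card \<L>" if "finite T" "card T = t" for T
    using L that by (auto simp: largest_t_star_def t_star_def)
  have ext: "(r - t + 1) * (M * card (star_at ?\<G> (insert x T))) \<le> (r - t) * card \<L>"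
    if T: "finite T" "card T = t" and x: "x \<notin> T" for x T
  proof -
    have "(r - t + 1) * (M * card (star_at ?\<G> (insert x T)))
        \<le> (min_base_size \<H> - r) * card (star_at ?\<G> (insert x T))"
      using mult_le_mono1[OF \<mu>] by (simp only: mult.assoc)
    also have "\<dots> \<le> (r - t) * card (star_at ?\<G> T)"
      using star_exchange[OF fin her x T(1)] T(2) by simp
    also have "\<dots> \<le> (r - t) * card \<L>"
      using starL[OF T] by simp
    finally show ?thesis .
  qed
  have LG: "M * card \<L> \<le> card ?\<G>"
  proof -
    obtain T where T: "finite T" "card T = t" "\<L> = star_at ?\<G> T"
      using L by (auto simp: largest_t_star_def t_star_def)
    then obtain x where x: "x \<in> T" using t by fastforce
    \<comment> \<open>One exchange, dropping \<open>x\<close> from the centre, suffices: its factor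
      \<open>r - (t - 1)\<close> cancels against \<open>r - t + 1\<close>, and \<open>M\<close>
      remains.\<close>
    have "(r - t + 1) * (M * card \<L>) \<le> (min_base_size \<H> - r) * card \<L>"
      using mult_le_mono1[OF \<mu>] by (simp only: mult.assoc)
    also have "\<dots> \<le> (r - (t - 1)) * card (star_at ?\<G> (T - {x}))"
      using star_exchange[OF fin her, of x "T - {x}" r] T x by (simp add: insert_absorb)
    also have "\<dots> \<le> (r - (t - 1)) * card ?\<G>"
      using finG by (intro mult_le_mono2 card_mono) (auto simp: star_at_def)
    also have "r - (t - 1) = r - t + 1"
      using t by simp
    finally show ?thesis by (simp only: mult_le_cancel1)
  qed
  have rM: "r * (r choose t) \<le> M"
  proof -
    have "(2 * r) choose (t + 1) \<le> M"
      unfolding M_def by (rule binomial_right_mono) (simp add: m_bound_def)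
    with mult_choose_le_choose_double[of r t] show ?thesis by linarith
  qed
  \<comment> \<open>The last case supplies both a good set \<open>C\<close> and, for each
    \<open>T\<close> with \<open>t\<close> elements, a set of \<open>U\<close> that does not include
    \<open>T\<close>.\<close>
  consider "S = {}" | T where "finite T" "card T = t" "\<And>A. A \<in> U \<Longrightarrow> T \<subseteq> A"
    | "S \<noteq> {}" "\<And>T. finite T \<Longrightarrow> card T = t \<Longrightarrow> \<exists>D\<in>U. \<not> T \<subseteq> D"
    by blast
  then show ?thesis
  proof cases
    case 1
    have "card U \<le> card ?\<G>"
      using U finG by (rule card_mono[rotated])
    with 1 show ?thesis by simp
  next
    case (2 T)
    have "A \<in> S" if A: "A \<in> U" for A
    proof -
      have "t \<le> card (A \<inter> B)" if "B \<in> U" for B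
        using 2 A that U finmem by (metis Int_greatest card_mono finite_Int subsetD)
      with A show ?thesis by (auto simp: S t_intersects_def)
    qed
    then have "U = S" using SU by blast
    moreover have "card U \<le> card \<L>"
    proof -
      have "card U \<le> card (star_at ?\<G> T)"
        using 2 U finG by (intro card_mono) (auto simp: star_at_def)
      with starL[of T] 2 show ?thesis by simp
    qed
    ultimately show ?thesis by simp
  next
    case 3
    then obtain C where C: "C \<in> S" by blast
    have finC: "finite C" "card C \<le> r"
      using C SU U finmem by auto
    have meetsC: "t_intersects t A C" if "A \<in> U" for A
      using C that by (auto simp: S t_intersects_def Int_commute)
    have bad: "(r - t + 1) * card (U - S) \<le> card ?\<G>"
    proof -
      have "card (U - S) \<le> (r choose t) * card \<L>"
      proof (rule card_le_by_stars[OF finC])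
        fix T assume "T \<subseteq> C" "card T = t"
        then have "card (star_at ?\<G> T) \<le> card \<L>"
          using finC finite_subset by (intro starL) auto
        moreover have "card (star_at (U - S) T) \<le> card (star_at ?\<G> T)"
          using U finG by (intro card_mono) (auto simp: star_at_def)
        ultimately show "card (star_at (U - S) T) \<le> card \<L>" by simp
      qed (use finU meetsC in auto)
      \<comment> \<open>As \<open>1 \<le> t\<close>, the factor \<open>r - t + 1\<close> is at most
        \<open>r\<close>, which produces the product bounded by \<open>rM\<close>.\<close>
      then have "(r - t + 1) * card (U - S) \<le> r * ((r choose t) * card \<L>)"
        using t by (intro mult_le_mono) auto
      also have "\<dots> \<le> M * card \<L>"
        using mult_le_mono1[OF rM] by (simp only: mult.assoc)
      finally show ?thesis using LG by simp
    qed
    have good: "(r - t + 1) * card S \<le> (r - t) * card \<L>"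
    proof -
      \<comment> \<open>The bound of \<open>ext\<close> on a star whose centre has
        \<open>t + 1\<close> elements, rounded down. Multiplying back by
        \<open>(r - t + 1) * M\<close> gives at most the dividend.\<close>
      define Z where "Z = (r - t) * card \<L> div ((r - t + 1) * M)"
      have pos: "0 < (r - t + 1) * M"
        using rM t zero_less_binomial[of t r] by (auto intro: Nat.gr0I)
      have "card S \<le> (r choose t) * (r * Z)"
      proof (rule card_le_by_stars[OF finC finS])
        fix T assume T: "T \<subseteq> C" "card T = t"
        then have finT: "finite T" using finC finite_subset by blast
        \<comment> \<open>\<open>D\<close> may be bad: the sets of \<open>S\<close>
          \<open>t\<close>-intersect every set of \<open>U\<close>.\<close>
        then obtain D where D: "D \<in> U" "\<not> T \<subseteq> D" using 3(2) T by blast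
        show "card (star_at S T) \<le> r * Z"
        proof (rule card_star_le_extended_stars[OF finT T(2) _ _ D(2) finS])
          fix x assume x: "x \<notin> T"
          have "card (star_at ?\<G> (insert x T)) \<le> Z"
            unfolding Z_def using ext[OF finT T(2) x] pos
            by (simp only: less_eq_div_iff_mult_less_eq ac_simps)
          moreover have "card (star_at S (insert x T)) \<le> card (star_at ?\<G> (insert x T))"
            using U SU finG by (intro card_mono) (auto simp: star_at_def)
          ultimately show "card (star_at S (insert x T)) \<le> Z" by simp
        qed (use D U finmem in \<open>auto simp: S\<close>)
      qed (use meetsC SU in auto)
      also have "\<dots> = r * (r choose t) * Z" by simp
      also have "\<dots> \<le> M * Z" using rM by (rule mult_le_mono1)
      finally have "(r - t + 1) * card S \<le> (r - t + 1) * (M * Z)" by (rule mult_le_mono2)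
      also have "\<dots> \<le> (r - t) * card \<L>"
        unfolding Z_def mult.assoc[symmetric] by (rule times_div_less_eq_dividend)
      finally show ?thesis .
    qed
    have "(r - t + 1) * (card S * card ?\<G> + card \<L> * card (U - S))
        = (r - t + 1) * card S * card ?\<G> + card \<L> * ((r - t + 1) * card (U - S))"
      by (simp only: algebra_simps)
    also have "\<dots> \<le> (r - t) * card \<L> * card ?\<G> + card \<L> * card ?\<G>"
      by (rule add_mono[OF mult_le_mono1[OF good] mult_le_mono2[OF bad]])
    also have "\<dots> = (r - t + 1) * (card \<L> * card ?\<G>)"
      by (simp add: algebra_simps)
    finally show ?thesis by (simp only: mult_le_cancel1)
  qed
qed

section \<open>From good sets to the sum of sizes\<close>

lemma sum_card_cross_t_intersecting_le:
  assumes fin: "\<And>i. i \<in> {1..k} \<Longrightarrow> finite (\<A> i)"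
    and cross: "cross_t_intersecting t k \<A>"
    and U: "U = (\<Union>i\<in>{1..k}. \<A> i)"
    and S: "S = {A \<in> U. \<forall>B\<in>U. t_intersects t A B}"
  shows "(\<Sum>i=1..k. card (\<A> i)) \<le> k * card S + card (U - S)"
proof -
  have finU: "finite U" using fin U by auto
  then have finS: "finite S" using S by auto
  have shared: "A \<in> S" if "i \<in> {1..k}" "j \<in> {1..k}" "i \<noteq> j" "A \<in> \<A> i" "A \<in> \<A> j" for A i j
  proof -
    have "t_intersects t A B" if B: "B \<in> U" for B
    proof -
      \<comment> \<open>The index \<open>l\<close> differs from \<open>i\<close> or from
        \<open>j\<close>, so \<open>A\<close> lies in a family other than the one chosen for
        \<open>B\<close>.\<close>
      obtain l where "l \<in> {1..k}" "B \<in> \<A> l" using B U by blast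
      then show ?thesis
        using that \<open>i \<in> {1..k}\<close> \<open>j \<in> {1..k}\<close> \<open>i \<noteq> j\<close> \<open>A \<in> \<A> i\<close> \<open>A \<in> \<A> j\<close> cross
        unfolding cross_t_intersecting_def by metis
    qed
    with that show ?thesis by (auto simp: S U)
  qed
  have "(\<Sum>i=1..k. card (\<A> i)) = (\<Sum>i=1..k. card (\<A> i \<inter> S) + card (\<A> i - S))"
    using fin by (intro sum.cong refl card_Int_Diff)
  also have "\<dots> = (\<Sum>i=1..k. card (\<A> i \<inter> S)) + (\<Sum>i=1..k. card (\<A> i - S))"
    by (rule sum.distrib)
  also have "(\<Sum>i=1..k. card (\<A> i - S)) = card (\<Union>i\<in>{1..k}. \<A> i - S)"
    using fin shared by (intro card_UN_disjoint[symmetric]) auto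
  also have "(\<Union>i\<in>{1..k}. \<A> i - S) = U - S"
    using U by auto
  also have "(\<Sum>i=1..k. card (\<A> i \<inter> S)) \<le> k * card S"
    using sum_bounded_above[of "{1..k}" "\<lambda>i. card (\<A> i \<inter> S)" "card S"] finS
    by (simp add: card_mono)
  finally show ?thesis by simp
qed

text \<open>For positive \<open>l\<close> and \<open>g\<close> the left side is
  \<open>(s / l) * (k * l) + (u / g) * g\<close>, with weights of sum at most 1, so it cannot exceed
  the larger of \<open>k * l\<close> and \<open>g\<close>. The proof multiplies by \<open>g\<close>
  and never divides by \<open>l\<close>.\<close>

lemma weighted_sum_le_max:
  fixes s u l g k :: nat
  assumes weighted: "s * g + l * u \<le> l * g" and u: "u \<le> g" and sg: "s \<le> g"
  shows "k * s + u \<le> max (k * l) g"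
\<comment> \<open>For \<open>g = 0\<close> the weighted inequality does not control
  \<open>s\<close>; there \<open>s \<le> g\<close> and \<open>u \<le> g\<close> make the left side
  0.\<close>
proof (cases "g = 0")
  case True
  with u sg show ?thesis by simp
next
  case False
  have "(k * s + u) * g = k * (s * g) + u * g"
    by (simp add: algebra_simps)
  also have "\<dots> \<le> max (k * l) g * g"
  proof -
    obtain v where v: "g = u + v" using u le_Suc_ex by blast
    have "s * g \<le> l * v" using weighted v by (simp add: algebra_simps)
    then have "k * (s * g) \<le> k * l * v" by (simp add: mult.assoc)
    also have "\<dots> \<le> max (k * l) g * v" by (rule mult_le_mono1) simp
    finally have "k * (s * g) + u * g \<le> max (k * l) g * v + max (k * l) g * u"
      by (intro add_mono) (auto simp: mult.commute intro: mult_le_mono)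
    then show ?thesis by (simp add: v algebra_simps)
  qed
  finally show ?thesis using False by simp
qed

theorem theorem2p3:
  fixes t r k :: nat
    and \<H> \<L> :: "'a set set"
    and \<A> :: "nat \<Rightarrow> 'a set set"
  assumes "1 \<le> t" and "t \<le> r" and "1 \<le> k"
    and "finite_family \<H>"
    and "hereditary \<H>"
    and "n_S r t \<le> min_base_size \<H>"
    and "\<And>i. i \<in> {1..k} \<Longrightarrow> \<A> i \<subseteq> upto_size \<H> r"
    and "cross_t_intersecting t k \<A>"
    and "largest_t_star t (upto_size \<H> r) \<L>"
  shows "(\<Sum>i=1..k. card (\<A> i)) \<le> max (k * card \<L>) (card (upto_size \<H> r))"
proof -
  define U where "U = (\<Union>i\<in>{1..k}. \<A> i)"
  define S where "S = {A \<in> U. \<forall>B\<in>U. t_intersects t A B}"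
  have fin: "finite (upto_size \<H> r)"
    using assms(4) by (simp add: finite_family_def upto_size_def)
  have U: "U \<subseteq> upto_size \<H> r"
    unfolding U_def using assms(7) by (rule UN_least)
  have "(\<Sum>i=1..k. card (\<A> i)) \<le> k * card S + card (U - S)"
    using fin assms(7) finite_subset
    by (intro sum_card_cross_t_intersecting_le[OF _ assms(8) U_def S_def]) blast
  also have "\<dots> \<le> max (k * card \<L>) (card (upto_size \<H> r))"
  proof (rule weighted_sum_le_max)
    show "card S * card (upto_size \<H> r) + card \<L> * card (U - S) \<le> card \<L> * card (upto_size \<H> r)"
      using good_part_weighted_bound[OF assms(1,2,4-6) U assms(9) S_def] .
    show "card (U - S) \<le> card (upto_size \<H> r)"
      using U fin by (intro card_mono) auto
    show "card S \<le> card (upto_size \<H> r)"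
      using U fin by (intro card_mono) (auto simp: S_def)
  qed
  finally show ?thesis .
qed

end
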